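(* Let $q$ be a prime power and let $f(x) = c_1 x^{a_1} + \cdots + c_t x^{a_t} \in \mathbb{F}_q[x]$, where the coefficients $c_i \in \mathbb{F}_q$ are all nonzero and the exponents $a_i$ are nonnegative integers. Define $$S(f) := \{\, k \in \mathbb{N} : k \mid (q-1), \text{ and for all } i \in \{1,\dots,t\} \text{ there is a } j \in \{1,\dots,t\} \text{ with } j \neq i \text{ and } a_i \equiv a_j \pmod{k} \,\}.$$ If $f$ vanishes at every element of some coset of size $k$ in $\mathbb{F}_q^*$, then $k \in S(f)$.
   Context: $\mathbb{F}_q$ is the finite field with $q$ elements and $\mathbb{F}_q^*$ is its (cyclic) multiplicative group. A coset of size $k$ in $\mathbb{F}_q^*$ means a coset $\alpha H$, where $\alpha \in \mathbb{F}_q^*$ and $H$ is the (unique) subgroup of $\mathbb{F}_q^*$ of order $k$ (so $k \mid q-1$). *)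

theory Defs
  imports
    "HOL-Algebra.Multiplicative_Group"
    "HOL-Algebra.Algebraic_Closure_Type"
    "HOL-Number_Theory.Cong"
    "HOL-Computational_Algebra.Polynomial"
begin

text \<open>
  The multiplicative group of a type-class field as an explicit group, with carrier the
  nonzero elements, so that subgroups and cosets are those of HOL-Algebra.
\<close>

definition mult_group :: "'a::field monoid" where
  "mult_group = mult_of ring_of_type_algebra"

definition coset_of_size :: "nat \<Rightarrow> 'a::field set \<Rightarrow> bool" where
  "coset_of_size k C \<longleftrightarrow>
     (\<exists>H. \<exists>\<alpha>\<in>carrier mult_group. subgroup H mult_group \<and> card H = k \<and> C = \<alpha> <#\<^bsub>mult_group\<^esub> H)"

text \<open>
  \<open>S_set q t a\<close> is $S(f)$ for $f = c_1 x^{a_1} + \cdots + c_t x^{a_t}$ over the field with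
  $q$ elements. It depends on $f$ only through the exponents of the given representation.
\<close>

definition S_set :: "nat \<Rightarrow> nat \<Rightarrow> (nat \<Rightarrow> nat) \<Rightarrow> nat set" where
  "S_set q t a =
     {k. k dvd q - 1 \<and> (\<forall>i\<in>{1..t}. \<exists>j\<in>{1..t}. j \<noteq> i \<and> [a i = a j] (mod k))}"

end

theory Submission
  imports Defs
begin

text \<open>
  On a coset $\alpha H$ with $|H| = k$, every $h \in H$ satisfies $h^k = 1$, so $f(\alpha h) = g(h)$
  where $g$ is obtained from $f(\alpha x)$ by reducing the exponents modulo $k$. Hence $g$ has
  degree below $k$ but at least $k$ roots, so $g = 0$. An exponent $a_i$ congruent to no other one
  would leave the nonzero coefficient $c_i \alpha^{a_i}$ in $g$.
\<close>

lemma carrier_mult_group [simp]: "carrier mult_group = - {0}"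
  by (auto simp: mult_group_def ring_of_type_algebra_def)

lemma mult_mult_group [simp]: "x \<otimes>\<^bsub>mult_group\<^esub> y = x * y"
  by (simp add: mult_group_def ring_of_type_algebra_def)

lemma one_mult_group [simp]: "\<one>\<^bsub>mult_group\<^esub> = 1"
  by (simp add: mult_group_def ring_of_type_algebra_def)

lemma group_mult_group: "group (mult_group :: 'a::field monoid)"
proof (rule groupI)
  fix x :: 'a assume "x \<in> carrier mult_group"
  then show "\<exists>y\<in>carrier mult_group. y \<otimes>\<^bsub>mult_group\<^esub> x = \<one>\<^bsub>mult_group\<^esub>"
    by (intro bexI[of _ "inverse x"]) auto
qed (auto simp: mult.assoc)

lemma pow_mult_group: "x [^]\<^bsub>mult_group\<^esub> (n::nat) = x ^ n"
  by (induction n) (auto simp: nat_pow_def mult.commute)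

text \<open>In a finite group the group order annihilates every element. This is applied to
  \<open>H\<close> as a group in its own right, whose powers agree with those of the field.\<close>

lemma subgroup_mult_group_power_card:
  fixes H :: "'a::field set"
  assumes "subgroup H mult_group" "finite H" "h \<in> H"
  shows "h ^ card H = 1"
proof -
  interpret group "mult_group :: 'a monoid" by (rule group_mult_group)
  interpret H: group "mult_group\<lparr>carrier := H\<rparr>"
    using assms(1) by (rule subgroup.subgroup_is_group) (rule group_mult_group)
  have "h [^]\<^bsub>mult_group\<lparr>carrier := H\<rparr>\<^esub> Coset.order (mult_group\<lparr>carrier := H\<rparr>) = 1"
    using H.pow_order_eq_1[of h] assms by simp
  then show ?thesis
    by (simp add: Coset.order_def nat_pow_consistent[symmetric] pow_mult_group)
qed

text \<open>Lagrange's theorem, since only 0 is missing from the group of units.\<close>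

lemma subgroup_mult_group_card_dvd:
  fixes H :: "'a::{field, finite} set"
  assumes "subgroup H mult_group"
  shows "card H dvd card (UNIV :: 'a set) - 1"
proof -
  have "Coset.order (mult_group :: 'a monoid) = card (UNIV :: 'a set) - 1"
    by (simp add: Coset.order_def Compl_eq_Diff_UNIV card_Diff_subset)
  then show ?thesis
    using group.lagrange[OF group_mult_group assms] by (metis dvd_triv_right)
qed

text \<open>Gives the strict bound that is played off against the number of roots. Positivity of
  \<open>k\<close> matters: \<open>e i mod 0\<close> is \<open>e i\<close>, and no degree is below
  0.\<close>

lemma degree_sum_monom_mod_less:
  assumes "0 < k"
  shows "degree (\<Sum>i\<in>A. Polynomial.monom (b i) (e i mod k)) < k"
proof -
  have "degree (\<Sum>i\<in>A. Polynomial.monom (b i) (e i mod k)) \<le> k - 1"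
  proof (cases "finite A")
    case True
    have "e i mod k \<le> k - 1" for i
      using mod_less_divisor[OF assms, of "e i"] by linarith
    with True show ?thesis
      by (intro degree_sum_le) (auto intro: order_trans[OF degree_monom_le])
  qed simp
  with assms show ?thesis by linarith
qed

theorem theorem2p2:
  fixes q t k :: nat
    and c :: "nat \<Rightarrow> 'a :: {field, finite}"
    and a :: "nat \<Rightarrow> nat"
    and f :: "'a poly"
    and C :: "'a set"
  assumes "card (UNIV :: 'a set) = q"
    and "f = (\<Sum>i=1..t. Polynomial.monom (c i) (a i))"
    and "\<And>i. i \<in> {1..t} \<Longrightarrow> c i \<noteq> 0"
    and "coset_of_size k C"
    and "\<And>x. x \<in> C \<Longrightarrow> poly f x = 0"
  shows "k \<in> S_set q t a"
proof -
  obtain H \<alpha> where \<alpha>: "\<alpha> \<noteq> 0" and H: "subgroup H mult_group" "card H = k"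
    and C: "C = (\<lambda>h. \<alpha> * h) ` H"
    using assms(4) by (auto simp: coset_of_size_def l_coset_def)
  have "1 \<in> H"
    using subgroup.one_closed[OF H(1)] by simp
  then have "0 < k"
    using H(2) by (auto simp: card_gt_0_iff)
  \<comment> \<open>Only the exponent of the variable is reduced: \<open>\<alpha>\<close> need not
    lie in \<open>H\<close>, so \<open>\<alpha> ^ k\<close> may differ from 1.\<close>
  define g where "g = (\<Sum>i=1..t. Polynomial.monom (c i * \<alpha> ^ a i) (a i mod k))"
  have root: "poly g h = 0" if h: "h \<in> H" for h
  proof -
    have hk: "h ^ k = 1"
      using subgroup_mult_group_power_card[OF H(1) _ h] H(2) by simp
    have "h ^ n = h ^ (n mod k)" for n
    proof -
      have "h ^ n = h ^ (k * (n div k) + n mod k)" by simp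
      also have "\<dots> = h ^ (n mod k)"
        by (simp only: power_add power_mult hk) simp
      finally show ?thesis .
    qed
    then have "poly f (\<alpha> * h) = poly g h"
      unfolding assms(2) g_def poly_sum poly_monom
      by (intro sum.cong) (simp_all add: power_mult_distrib mult.assoc)
    moreover have "\<alpha> * h \<in> C"
      using C h by blast
    ultimately show ?thesis
      using assms(5) by metis
  qed
  have "g = 0"
  proof (rule ccontr)
    assume "g \<noteq> 0"
    \<comment> \<open>All \<open>k\<close> elements of \<open>H\<close> are among the roots of
      \<open>g\<close>.\<close>
    have "k \<le> card {x. poly g x = 0}"
      using root H(2) by (metis (mono_tags) card_mono finite mem_Collect_eq subsetI)
    also have "\<dots> \<le> degree g"
      using \<open>g \<noteq> 0\<close> by (rule card_poly_roots_bound)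
    also have "\<dots> < k"
      unfolding g_def using \<open>0 < k\<close> by (rule degree_sum_monom_mod_less)
    finally show False by simp
  qed
  have "\<exists>j\<in>{1..t}. j \<noteq> i \<and> [a i = a j] (mod k)" if i: "i \<in> {1..t}" for i
  proof (rule ccontr)
    assume isolated: "\<not> ?thesis"
    \<comment> \<open>The \<open>j\<close>-th monomial contributes to this coefficient exactly when
      \<open>a j\<close> and \<open>a i\<close> are congruent modulo \<open>k\<close>, which
      \<open>isolated\<close> excludes for \<open>j\<close> other than \<open>i\<close>.\<close>
    have "coeff g (a i mod k) = (\<Sum>j=1..t. if j = i then c j * \<alpha> ^ a j else 0)"
      unfolding g_def coeff_sum using isolated
      by (intro sum.cong) (auto simp: cong_def)
    also have "\<dots> = c i * \<alpha> ^ a i"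
      using i by simp
    finally show False
      using \<open>g = 0\<close> \<alpha> assms(3)[OF i] by simp
  qed
  moreover have "k dvd q - 1"
    using subgroup_mult_group_card_dvd[OF H(1)] H(2) assms(1) by simp
  ultimately show ?thesis
    by (simp add: S_set_def)
qed

end
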